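(* Let $p$ be a prime. The group $\mathrm{ULT}(3,p)$ has disconnected commuting graph, while for every integer $n \geq 4$ the commuting graph of $\mathrm{ULT}(n,p)$ has diameter $3$.
   Context: $\mathrm{ULT}(n,p)$ denotes the group of all $n\times n$ lower unitriangular matrices over the field $\mathbb{Z}_p$ of integers modulo $p$, i.e. lower triangular matrices all of whose entries on the main diagonal are $1$. The commuting graph of a group $G$ is the simple undirected graph whose vertices are the non-central elements of $G$, with two distinct vertices $x,y$ adjacent if and only if $xy=yx$. The distance between two vertices is the length of a shortest path between them ($\infty$ if there is none), and the diameter is the maximum distance between two vertices. *)

theory Defs
  imports
    "HOL-Library.Extended_Nat"
    "HOL-Algebra.Group"
    "Graph_Theory.Graph_Theory"
    "Jordan_Normal_Form.Matrix"
    "Berlekamp_Zassenhaus.Finite_Field"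
begin

text \<open>The prime \<open>p\<close> is the cardinality of \<open>'p :: prime_card\<close>; the field \<open>'p mod_ring\<close> is then the
  ring of integers modulo \<open>p\<close>. The type argument only serves to make \<open>'p\<close> visible.\<close>

definition ULT :: "nat \<Rightarrow> 'p :: prime_card itself \<Rightarrow> 'p mod_ring mat monoid" where
  "ULT n _ =
    \<lparr> carrier = {A \<in> carrier_mat n n.
        (\<forall>i<n. A $$ (i, i) = 1) \<and> (\<forall>i<n. \<forall>j<n. i < j \<longrightarrow> A $$ (i, j) = 0)},
      mult = (*),
      one = 1\<^sub>m n \<rparr>"

definition group_center :: "('a, 'b) monoid_scheme \<Rightarrow> 'a set" where
  "group_center G = {z \<in> carrier G. \<forall>g \<in> carrier G. z \<otimes>\<^bsub>G\<^esub> g = g \<otimes>\<^bsub>G\<^esub> z}"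

text \<open>As usual in \<^theory>\<open>Graph_Theory.Digraph\<close>, a simple undirected graph is a loop-free
  symmetric digraph: each edge \<open>{x, y}\<close> is the pair of arcs \<open>(x, y)\<close>, \<open>(y, x)\<close>.\<close>

definition commuting_graph :: "('a, 'b) monoid_scheme \<Rightarrow> ('a, 'a \<times> 'a) pre_digraph" where
  "commuting_graph G =
    \<lparr> verts = carrier G - group_center G,
      arcs = {(x, y). x \<in> carrier G - group_center G \<and> y \<in> carrier G - group_center G \<and>
                x \<noteq> y \<and> x \<otimes>\<^bsub>G\<^esub> y = y \<otimes>\<^bsub>G\<^esub> x},
      tail = fst,
      head = snd \<rparr>"

lemma wf_digraph_commuting_graph: "wf_digraph (commuting_graph G)"
  by unfold_locales (auto simp: commuting_graph_def)

lemma loopfree_digraph_commuting_graph: "loopfree_digraph (commuting_graph G)"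
  by unfold_locales (auto simp: commuting_graph_def)

lemma nomulti_digraph_commuting_graph: "nomulti_digraph (commuting_graph G)"
  by unfold_locales (auto simp: commuting_graph_def arc_to_ends_def)

lemma sym_digraph_commuting_graph: "sym_digraph (commuting_graph G)"
  by unfold_locales (auto simp: commuting_graph_def symmetric_conv)

text \<open>A path is represented by its list of arcs, so its length is the number of edges. The
  infimum of the empty set in \<^typ>\<open>enat\<close> is \<open>\<infinity>\<close>, and a nonempty infimum is attained.\<close>

definition graph_dist :: "('a, 'b) pre_digraph \<Rightarrow> 'a \<Rightarrow> 'a \<Rightarrow> enat" where
  "graph_dist G u v = (INF p \<in> {p. pre_digraph.apath G u p v}. enat (length p))"

text \<open>For a finite nonempty graph the supremum is a maximum.\<close>

definition graph_diameter :: "('a, 'b) pre_digraph \<Rightarrow> enat" where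
  "graph_diameter G = (SUP u \<in> verts G. SUP v \<in> verts G. graph_dist G u v)"

end

theory Submission
  imports Defs
begin

text \<open>
  For \<open>n \<ge> 4\<close> the matrices \<open>1 + a E\<^bsub>n-1,1\<^esub> + b E\<^bsub>n,2\<^esub>\<close> (rows and columns counted from 1) commute
  with each other and are non-central unless \<open>a = b = 0\<close>. Every unitriangular \<open>A\<close> commutes with
  such a non-central matrix: take \<open>a = A\<^bsub>2,1\<^esub>\<close> and \<open>b = A\<^bsub>n,n-1\<^esub>\<close>, or \<open>a = 1\<close> and \<open>b = 0\<close> if both
  entries vanish. So distances are at most 3. If \<open>J\<close> is the nilpotent shift, a matrix commuting
  with \<open>1 + J\<close> is constant along diagonals, and one that also commutes with \<open>1 + E\<^bsub>2,1\<^esub>\<close> is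
  central; hence these two vertices have distance at least 3. For \<open>n = 3\<close> the non-central matrices
  with \<open>A\<^bsub>2,1\<^esub> = A\<^bsub>3,2\<^esub>\<close> are closed under adjacency, contain \<open>1 + J\<close> and miss \<open>1 + E\<^bsub>2,1\<^esub>\<close>.
\<close>

section \<open>Distances in commuting graphs\<close>

text \<open>A path repeats no arc and uses only arcs of the walk, so both lengths can be compared
  through the cardinalities of the arc sets.\<close>

lemma (in wf_digraph) length_awalk_to_apath:
  assumes "awalk u p v"
  shows "length (awalk_to_apath p) \<le> length p"
proof -
  have "distinct (awalk_to_apath p)"
    using apath_awalk_to_apath[OF assms] by (auto simp: apath_def intro: distinct_verts_imp_distinct)
  then have "length (awalk_to_apath p) = card (set (awalk_to_apath p))"
    by (simp add: distinct_card)
  also have "\<dots> \<le> card (set p)"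
    using awalk_to_apath_subset[OF assms] by (simp add: card_mono)
  also have "\<dots> \<le> length p" by (rule card_length)
  finally show ?thesis .
qed

text \<open>Upper bounds on distances may thus come from walks, which, unlike paths, can be
  concatenated freely.\<close>

lemma (in wf_digraph) graph_dist_le_awalk:
  assumes "awalk u p v"
  shows "graph_dist G u v \<le> enat (length p)"
proof -
  have "graph_dist G u v \<le> enat (length (awalk_to_apath p))"
    unfolding graph_dist_def using apath_awalk_to_apath[OF assms] by (auto intro: INF_lower)
  also have "\<dots> \<le> enat (length p)" using length_awalk_to_apath[OF assms] by simp
  finally show ?thesis .
qed

lemma commuting_graph_simps:
  "verts (commuting_graph G) = carrier G - group_center G"
  "a \<in> arcs (commuting_graph G) \<longleftrightarrow> fst a \<in> carrier G - group_center G \<and>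
    snd a \<in> carrier G - group_center G \<and> fst a \<noteq> snd a \<and>
    fst a \<otimes>\<^bsub>G\<^esub> snd a = snd a \<otimes>\<^bsub>G\<^esub> fst a"
  "tail (commuting_graph G) = fst" "head (commuting_graph G) = snd"
  by (auto simp: commuting_graph_def)

text \<open>Admitting \<open>x = y\<close>, served by the empty walk, avoids case distinctions when
  intermediate vertices happen to coincide.\<close>

lemma commuting_graph_short_awalk:
  assumes "x \<in> verts (commuting_graph G)" "y \<in> verts (commuting_graph G)"
    and "x \<otimes>\<^bsub>G\<^esub> y = y \<otimes>\<^bsub>G\<^esub> x"
  shows "\<exists>p. pre_digraph.awalk (commuting_graph G) x p y \<and> length p \<le> 1"
proof -
  interpret wf_digraph "commuting_graph G" by (rule wf_digraph_commuting_graph)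
  show ?thesis
  proof (cases "x = y")
    case True
    then show ?thesis using assms by (intro exI[of _ "[]"]) (simp add: awalk_Nil_iff)
  next
    case False
    then show ?thesis using assms
      by (intro exI[of _ "[(x, y)]"]) (auto simp: awalk_Cons_iff awalk_Nil_iff commuting_graph_simps)
  qed
qed

lemma commuting_graph_dist_le_3:
  assumes "x \<in> verts (commuting_graph G)" "z \<in> verts (commuting_graph G)"
    and "w \<in> verts (commuting_graph G)" "y \<in> verts (commuting_graph G)"
    and "x \<otimes>\<^bsub>G\<^esub> z = z \<otimes>\<^bsub>G\<^esub> x" "z \<otimes>\<^bsub>G\<^esub> w = w \<otimes>\<^bsub>G\<^esub> z" "w \<otimes>\<^bsub>G\<^esub> y = y \<otimes>\<^bsub>G\<^esub> w"
  shows "graph_dist (commuting_graph G) x y \<le> 3"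
proof -
  interpret wf_digraph "commuting_graph G" by (rule wf_digraph_commuting_graph)
  obtain p q r where "awalk x p z" "awalk z q w" "awalk w r y"
    and len: "length p \<le> 1" "length q \<le> 1" "length r \<le> 1"
    using assms commuting_graph_short_awalk by metis
  then have "awalk x (p @ q @ r) y" by (meson awalk_appendI)
  then have "graph_dist (commuting_graph G) x y \<le> enat (length (p @ q @ r))"
    by (rule graph_dist_le_awalk)
  also have "\<dots> \<le> enat 3" using len by simp
  finally show ?thesis by (simp add: numeral_eq_enat)
qed

text \<open>A path of length 0 or 1 would make \<open>x\<close> and \<open>y\<close> commute; the
  middle vertex of a path of length 2 would be a non-central element commuting with both.\<close>

lemma commuting_graph_dist_ge_3:
  assumes "x \<in> carrier G" "y \<in> carrier G" "x \<otimes>\<^bsub>G\<^esub> y \<noteq> y \<otimes>\<^bsub>G\<^esub> x"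
    and central: "\<And>z. z \<in> carrier G \<Longrightarrow> x \<otimes>\<^bsub>G\<^esub> z = z \<otimes>\<^bsub>G\<^esub> x \<Longrightarrow> y \<otimes>\<^bsub>G\<^esub> z = z \<otimes>\<^bsub>G\<^esub> y \<Longrightarrow>
      z \<in> group_center G"
  shows "3 \<le> graph_dist (commuting_graph G) x y"
proof -
  interpret wf_digraph "commuting_graph G" by (rule wf_digraph_commuting_graph)
  have "3 \<le> length p" if "apath x p y" for p
  proof (rule ccontr)
    assume "\<not> 3 \<le> length p"
    then have "p = [] \<or> (\<exists>a. p = [a]) \<or> (\<exists>a b. p = [a, b])"
      by (cases p; cases "tl p"; cases "tl (tl p)") auto
    then consider "p = []" | a where "p = [a]" | a b where "p = [a, b]" by blast
    then show False
    proof cases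
      case 1
      then show ?thesis using that assms by (auto simp: apath_def awalk_Nil_iff)
    next
      case 2
      then show ?thesis using that assms
        by (auto simp: apath_def awalk_Cons_iff awalk_Nil_iff commuting_graph_simps)
    next
      case 3
      then have "\<exists>z \<in> carrier G - group_center G. x \<otimes>\<^bsub>G\<^esub> z = z \<otimes>\<^bsub>G\<^esub> x \<and> z \<otimes>\<^bsub>G\<^esub> y = y \<otimes>\<^bsub>G\<^esub> z"
        using that by (auto simp: apath_def awalk_Cons_iff awalk_Nil_iff commuting_graph_simps)
      then show ?thesis using central by auto
    qed
  qed
  then have "enat 3 \<le> graph_dist (commuting_graph G) x y"
    unfolding graph_dist_def by (auto intro!: INF_greatest)
  then show ?thesis by (simp add: numeral_eq_enat)
qed

text \<open>By induction along arcs, \<open>P\<close> spreads from \<open>x\<close> to everything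
  reachable from it, so \<open>y\<close> is out of reach.\<close>

lemma commuting_graph_not_connected:
  assumes x: "x \<in> verts (commuting_graph G)" "P x"
    and y: "y \<in> verts (commuting_graph G)" "\<not> P y"
    and closed: "\<And>u v. u \<in> verts (commuting_graph G) \<Longrightarrow> v \<in> verts (commuting_graph G) \<Longrightarrow>
      u \<otimes>\<^bsub>G\<^esub> v = v \<otimes>\<^bsub>G\<^esub> u \<Longrightarrow> P u \<Longrightarrow> P v"
  shows "\<not> Digraph_Component.connected (commuting_graph G)"
proof
  interpret sym_digraph "commuting_graph G" by (rule sym_digraph_commuting_graph)
  assume "Digraph_Component.connected (commuting_graph G)"
  \<comment> \<open>Connectedness is defined through the symmetric closure, which has the same
    reachability relation since the graph is symmetric already.\<close>
  then have "x \<rightarrow>\<^sup>*\<^bsub>commuting_graph G\<^esub> y"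
    using x y reachable_mk_symmetric_eq[OF sym_arcs]
    by (auto simp: connected_def strongly_connected_def)
  then have "P y"
  proof (induction rule: reachable_induct)
    case base
    then show ?case using x by simp
  next
    case (step u v)
    from step(2) have "u \<in> verts (commuting_graph G)" "v \<in> verts (commuting_graph G)"
      "u \<otimes>\<^bsub>G\<^esub> v = v \<otimes>\<^bsub>G\<^esub> u"
      by (auto simp: commuting_graph_def arcs_ends_conv)
    then show ?case using closed step by blast
  qed
  then show False using y by simp
qed

section \<open>Products with unit and shift matrices\<close>

definition unit_entry :: "nat \<Rightarrow> nat \<Rightarrow> nat \<Rightarrow> 'a \<Rightarrow> 'a :: semiring_1 mat" where
  "unit_entry n r s a = mat n n (\<lambda>(i, j). if i = r \<and> j = s then a else 0)"

text \<open>The nilpotent Jordan block with ones just below the diagonal: it moves rows down from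
  the left and columns to the left from the right.\<close>

definition shift :: "nat \<Rightarrow> 'a :: semiring_1 mat" where
  "shift n = mat n n (\<lambda>(i, j). if i = Suc j then 1 else 0)"

lemma unit_entry_carrier [simp]: "unit_entry n r s a \<in> carrier_mat n n"
  by (simp add: unit_entry_def)

lemma shift_carrier [simp]: "shift n \<in> carrier_mat n n"
  by (simp add: shift_def)

lemma dim_unit_entry [simp]: "dim_row (unit_entry n r s a) = n" "dim_col (unit_entry n r s a) = n"
  by (simp_all add: unit_entry_def)

lemma dim_shift [simp]: "dim_row (shift n) = n" "dim_col (shift n) = n"
  by (simp_all add: shift_def)

lemma index_unit_entry [simp]:
  "i < n \<Longrightarrow> j < n \<Longrightarrow> unit_entry n r s a $$ (i, j) = (if i = r \<and> j = s then a else 0)"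
  by (simp add: unit_entry_def)

lemma index_shift [simp]:
  "i < n \<Longrightarrow> j < n \<Longrightarrow> shift n $$ (i, j) = (if i = Suc j then 1 else 0)"
  by (simp add: shift_def)

lemma index_mult_mat_sum:
  assumes "A \<in> carrier_mat n n" "B \<in> carrier_mat n n" "i < n" "j < n"
  shows "(A * B) $$ (i, j) = (\<Sum>k<n. A $$ (i, k) * B $$ (k, j))"
  using assms by (simp add: scalar_prod_def atLeast0LessThan)

lemma index_unit_entry_mult [simp]:
  fixes a :: "'a :: comm_ring_1"
  assumes "A \<in> carrier_mat n n" "s < n" "i < n" "j < n"
  shows "(unit_entry n r s a * A) $$ (i, j) = (if i = r then a * A $$ (s, j) else 0)"
proof -
  have "(unit_entry n r s a * A) $$ (i, j) =
      (\<Sum>k<n. if k = s then (if i = r then a * A $$ (s, j) else 0) else 0)"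
    unfolding index_mult_mat_sum[OF unit_entry_carrier assms(1,3,4)]
    using assms by (intro sum.cong) auto
  then show ?thesis using assms by simp
qed

lemma index_mult_unit_entry [simp]:
  fixes a :: "'a :: comm_ring_1"
  assumes "A \<in> carrier_mat n n" "r < n" "i < n" "j < n"
  shows "(A * unit_entry n r s a) $$ (i, j) = (if j = s then A $$ (i, r) * a else 0)"
proof -
  have "(A * unit_entry n r s a) $$ (i, j) =
      (\<Sum>k<n. if k = r then (if j = s then A $$ (i, r) * a else 0) else 0)"
    unfolding index_mult_mat_sum[OF assms(1) unit_entry_carrier assms(3,4)]
    using assms by (intro sum.cong) auto
  then show ?thesis using assms by simp
qed

lemma index_shift_mult [simp]:
  fixes A :: "'a :: comm_ring_1 mat"
  assumes "A \<in> carrier_mat n n" "i < n" "j < n"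
  shows "(shift n * A) $$ (i, j) = (if i = 0 then 0 else A $$ (i - 1, j))"
proof -
  \<comment> \<open>For \<open>i = 0\<close> truncated subtraction gives \<open>i - 1 = 0\<close>, a
    valid index; the inner conditional makes that summand vanish.\<close>
  have "(shift n * A) $$ (i, j) =
      (\<Sum>k<n. if k = i - 1 then (if i = 0 then 0 else A $$ (i - 1, j)) else 0)"
    unfolding index_mult_mat_sum[OF shift_carrier assms]
    using assms by (intro sum.cong) auto
  then show ?thesis using assms by simp
qed

lemma index_mult_shift [simp]:
  fixes A :: "'a :: comm_ring_1 mat"
  assumes "A \<in> carrier_mat n n" "i < n" "j < n"
  shows "(A * shift n) $$ (i, j) = (if Suc j < n then A $$ (i, Suc j) else 0)"
proof -
  \<comment> \<open>For \<open>Suc j = n\<close> no \<open>k\<close> in range matches, so the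
    out-of-range entry of \<open>A\<close> never enters the sum.\<close>
  have "(A * shift n) $$ (i, j) = (\<Sum>k<n. if k = Suc j then A $$ (i, Suc j) else 0)"
    unfolding index_mult_mat_sum[OF assms(1) shift_carrier assms(2,3)]
    using assms by (intro sum.cong) auto
  then show ?thesis using assms by simp
qed

lemma one_plus_commute_iff:
  fixes A M :: "'a :: comm_ring_1 mat"
  assumes "M \<in> carrier_mat n n" "A \<in> carrier_mat n n"
  shows "(1\<^sub>m n + M) * A = A * (1\<^sub>m n + M) \<longleftrightarrow> M * A = A * M"
proof -
  have eq: "(1\<^sub>m n + M) * A = A + M * A" "A * (1\<^sub>m n + M) = A + A * M"
    using assms add_mult_distrib_mat[of "1\<^sub>m n" n n M A n]
      mult_add_distrib_mat[of A n n "1\<^sub>m n" n M] by simp_all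
  have "M * A = A * M" if *: "A + M * A = A + A * M"
  proof (rule eq_matI)
    fix i j assume "i < dim_row (A * M)" "j < dim_col (A * M)"
    then have "i < n" "j < n" using assms by auto
    moreover have "(A + M * A) $$ (i, j) = (A + A * M) $$ (i, j)" using * by simp
    ultimately show "(M * A) $$ (i, j) = (A * M) $$ (i, j)"
      using assms by (simp del: index_mult_mat(1))
  qed (use assms in auto)
  then show ?thesis using eq by auto
qed

lemma mult_eq_iff_index:
  assumes "A \<in> carrier_mat n n" "B \<in> carrier_mat n n"
  shows "A * B = B * A \<longleftrightarrow> (\<forall>i<n. \<forall>j<n. (A * B) $$ (i, j) = (B * A) $$ (i, j))"
  using assms by (auto intro!: eq_matI simp del: index_mult_mat(1))

section \<open>Commuting unitriangular matrices\<close>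

abbreviation ult_carrier :: "nat \<Rightarrow> 'p :: prime_card mod_ring mat set" where
  "ult_carrier n \<equiv> carrier (ULT n TYPE('p))"

lemma ULT_mult [simp]: "A \<otimes>\<^bsub>ULT n T\<^esub> B = A * B"
  by (simp add: ULT_def)

lemma ULT_carrierI:
  assumes "A \<in> carrier_mat n n" "\<And>i. i < n \<Longrightarrow> A $$ (i, i) = 1"
    and "\<And>i j. i < j \<Longrightarrow> j < n \<Longrightarrow> A $$ (i, j) = 0"
  shows "A \<in> carrier (ULT n T)"
  using assms by (simp add: ULT_def)

lemma ULT_carrierD:
  assumes "A \<in> carrier (ULT n T)"
  shows "A \<in> carrier_mat n n" "\<And>i. i < n \<Longrightarrow> A $$ (i, i) = 1"
    and "\<And>i j. i < j \<Longrightarrow> j < n \<Longrightarrow> A $$ (i, j) = 0"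
  using assms by (simp_all add: ULT_def)

lemma one_plus_unit_entry_in_ULT:
  assumes "s < r"
  shows "1\<^sub>m n + unit_entry n r s a \<in> carrier (ULT n T)"
  using assms by (intro ULT_carrierI) auto

lemma one_plus_shift_in_ULT: "1\<^sub>m n + shift n \<in> carrier (ULT n T)"
  by (intro ULT_carrierI) auto

lemma in_verts_commuting_ULT:
  assumes "A \<in> carrier (ULT n T)" "B \<in> carrier (ULT n T)" "A * B \<noteq> B * A"
  shows "A \<in> verts (commuting_graph (ULT n T))"
  using assms by (auto simp: commuting_graph_def group_center_def)

text \<open>Such a matrix is the identity plus a multiple of the bottom left matrix unit
  \<open>E\<close>. Only the first row of \<open>B\<close> enters \<open>E * B\<close> and only its
  last column enters \<open>B * E\<close>; for unitriangular \<open>B\<close> these are unit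
  vectors, so both products equal \<open>E\<close>.\<close>

lemma ULT_centerI:
  assumes "n > 0" and A: "A \<in> carrier (ULT n T)"
    and "\<And>i j. j < i \<Longrightarrow> i < n \<Longrightarrow> (i, j) \<noteq> (n - 1, 0) \<Longrightarrow> A $$ (i, j) = 0"
  shows "A \<in> group_center (ULT n T)"
proof -
  define E where "E = unit_entry n (n - 1) 0 (A $$ (n - 1, 0))"
  \<comment> \<open>For \<open>n = 1\<close> the corner lies on the diagonal and
    \<open>1\<^sub>m n + E\<close> would have the entry 2.\<close>
  have "A = 1\<^sub>m n + E" if "n \<noteq> 1"
  proof (rule eq_matI)
    fix i j assume "i < dim_row (1\<^sub>m n + E)" "j < dim_col (1\<^sub>m n + E)"
    then have ij: "i < n" "j < n" by (auto simp: E_def)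
    consider "i = j" | "i < j" | "j < i" by linarith
    then show "A $$ (i, j) = (1\<^sub>m n + E) $$ (i, j)"
      by cases (use that ij assms(3)[of j i] ULT_carrierD(2,3)[OF A] in \<open>auto simp: E_def\<close>)
  qed (use ULT_carrierD(1)[OF A] in \<open>auto simp: E_def\<close>)
  moreover have "A = 1\<^sub>m n" if "n = 1"
    using that ULT_carrierD(1,2)[OF A] by (intro eq_matI) auto
  moreover have "(1\<^sub>m n + E) * B = B * (1\<^sub>m n + E)" if B: "B \<in> carrier (ULT n T)" for B
  proof -
    note B' = ULT_carrierD[OF B]
    have "(E * B) $$ (i, j) = (B * E) $$ (i, j)" if "i < n" "j < n" for i j
    proof -
      have "B $$ (0, j) = (if j = 0 then 1 else 0)" "B $$ (i, n - 1) = (if i = n - 1 then 1 else 0)"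
        using B'(2,3) that by auto
      then show ?thesis using B'(1) that by (auto simp: E_def simp del: index_mult_mat(1))
    qed
    then have "E * B = B * E"
      using B' by (subst mult_eq_iff_index[of _ n]) (auto simp: E_def)
    then show ?thesis using B' by (subst one_plus_commute_iff) (auto simp: E_def)
  qed
  ultimately have "A * B = B * A" if "B \<in> carrier (ULT n T)" for B
    using that ULT_carrierD(1)[OF that] by (cases "n = 1") auto
  then show ?thesis using A by (simp add: group_center_def)
qed

section \<open>Matrices supported next to the bottom left corner\<close>

definition corner :: "nat \<Rightarrow> 'a \<Rightarrow> 'a \<Rightarrow> 'a :: semiring_1 mat" where
  "corner n a b = 1\<^sub>m n + (unit_entry n (n - 2) 0 a + unit_entry n (n - 1) 1 b)"

lemma corner_in_ULT: "n \<ge> 3 \<Longrightarrow> corner n a b \<in> carrier (ULT n T)"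
  unfolding corner_def by (intro ULT_carrierI) auto

text \<open>The perturbation contributes rows \<open>n - 2\<close> and \<open>n - 1\<close> from the
  left and columns 0 and 1 from the right. Unitriangularity makes all entries of the two products
  agree except possibly the one at \<open>(n - 1, 0)\<close>, which yields the condition.\<close>

lemma corner_commute_iff:
  assumes "n \<ge> 3" and A: "A \<in> carrier (ULT n T)"
  shows "corner n a b * A = A * corner n a b \<longleftrightarrow> b * A $$ (1, 0) = A $$ (n - 1, n - 2) * a"
proof -
  define E F where "E = unit_entry n (n - 2) 0 a" and "F = unit_entry n (n - 1) 1 b"
  have EF: "E \<in> carrier_mat n n" "F \<in> carrier_mat n n" by (auto simp: E_def F_def)
  note A' = ULT_carrierD[OF A]
  have "corner n a b * A = A * corner n a b \<longleftrightarrow> (E + F) * A = A * (E + F)"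
    unfolding corner_def E_def[symmetric] F_def[symmetric]
    using EF A' by (intro one_plus_commute_iff) auto
  also have "\<dots> \<longleftrightarrow> E * A + F * A = A * E + A * F"
    using EF A' by (simp add: add_mult_distrib_mat[of _ n n] mult_add_distrib_mat[of _ n n])
  also have "\<dots> \<longleftrightarrow> (\<forall>i<n. \<forall>j<n.
      (if i = n - 2 then a * A $$ (0, j) else 0) + (if i = n - 1 then b * A $$ (1, j) else 0) =
      (if j = 0 then A $$ (i, n - 2) * a else 0) + (if j = 1 then A $$ (i, n - 1) * b else 0))"
    (is "?L \<longleftrightarrow> ?R")
  proof -
    have 1: "(E * A + F * A) $$ (i, j) =
      (if i = n - 2 then a * A $$ (0, j) else 0) + (if i = n - 1 then b * A $$ (1, j) else 0)"
      if "i < n" "j < n" for i j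
      using that A' assms(1) by (simp add: E_def F_def del: index_mult_mat(1))
    have 2: "(A * E + A * F) $$ (i, j) =
      (if j = 0 then A $$ (i, n - 2) * a else 0) + (if j = 1 then A $$ (i, n - 1) * b else 0)"
      if "i < n" "j < n" for i j
      using that A' assms(1) by (simp add: E_def F_def del: index_mult_mat(1))
    have "?L \<longleftrightarrow> (\<forall>i<n. \<forall>j<n. (E * A + F * A) $$ (i, j) = (A * E + A * F) $$ (i, j))"
      using EF A' by (auto intro!: eq_matI simp del: index_mult_mat(1) index_add_mat(1))
    then show ?thesis using 1 2 by simp
  qed
  also have "\<dots> \<longleftrightarrow> b * A $$ (1, 0) = A $$ (n - 1, n - 2) * a"
  proof
    assume R: ?R
    have n: "n - 1 < n" "0 < n" "n - 1 \<noteq> n - 2" using assms(1) by auto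
    show "b * A $$ (1, 0) = A $$ (n - 1, n - 2) * a"
      using R[rule_format, OF n(1,2)] n(3) by simp
  next
    assume *: "b * A $$ (1, 0) = A $$ (n - 1, n - 2) * a"
    show ?R
    proof (intro allI impI)
      fix i j assume ij: "i < n" "j < n"
      have i: "i = n - 1 \<or> i = n - 2 \<or> i < n - 2" using ij by linarith
      have j: "j = 0 \<or> j = 1 \<or> 1 < j" by linarith
      have n: "n - 1 \<noteq> n - 2" "n - 2 < n - 1" "n - 2 < n" "n - 1 < n" "1 < n" "0 < n"
        using assms(1) by auto
      have i': "A $$ (i, n - 2) = 0" "A $$ (i, n - 1) = 0" if "i < n - 2"
        using A'(3)[of i] n that by auto
      have j': "A $$ (0, j) = 0" "A $$ (1, j) = 0" if "1 < j" using A'(3)[of _ j] ij that by auto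
      have d: "A $$ (0, 0) = 1" "A $$ (0, Suc 0) = 0" "A $$ (Suc 0, Suc 0) = 1"
        "A $$ (n - 2, n - 2) = 1" "A $$ (n - 1, n - 1) = 1" "A $$ (n - 2, n - 1) = 0"
        using A'(2,3) n by auto
      show "(if i = n - 2 then a * A $$ (0, j) else 0) + (if i = n - 1 then b * A $$ (1, j) else 0) =
        (if j = 0 then A $$ (i, n - 2) * a else 0) + (if j = 1 then A $$ (i, n - 1) * b else 0)"
        using i j n(1) d i' j' * by (elim disjE) auto
    qed
  qed
  finally show ?thesis .
qed

lemma corner_in_verts:
  fixes a b :: "'p :: prime_card mod_ring"
  assumes "n \<ge> 4" "a \<noteq> 0 \<or> b \<noteq> 0"
  shows "corner n a b \<in> verts (commuting_graph (ULT n TYPE('p)))"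
proof -
  \<comment> \<open>An elementary matrix makes one side of the criterion vanish and the other not:
    its entry is at \<open>(1, 0)\<close> if \<open>a = 0\<close>, at \<open>(n - 1, n - 2)\<close>
    otherwise.\<close>
  have "\<exists>B \<in> ult_carrier n. b * B $$ (1, 0) \<noteq> B $$ (n - 1, n - 2) * a"
  proof (cases "a = 0")
    case True
    then show ?thesis using assms
      by (intro bexI[of _ "1\<^sub>m n + unit_entry n 1 0 1"] one_plus_unit_entry_in_ULT) simp_all
  next
    case False
    then show ?thesis using assms
      by (intro bexI[of _ "1\<^sub>m n + unit_entry n (n - 1) (n - 2) 1"] one_plus_unit_entry_in_ULT) auto
  qed
  then obtain B where B: "B \<in> ult_carrier n" "b * B $$ (1, 0) \<noteq> B $$ (n - 1, n - 2) * a" ..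
  have n: "n \<ge> 3" using assms by simp
  show ?thesis
    using B corner_commute_iff[OF n B(1), of a b]
    by (intro in_verts_commuting_ULT[OF corner_in_ULT[OF n] B(1)]) simp
qed

text \<open>The commutation criterion is one homogeneous linear equation in the two unknowns
  \<open>a\<close> and \<open>b\<close>, so it has a nonzero solution.\<close>

lemma exists_commuting_corner:
  fixes A :: "'p :: prime_card mod_ring mat"
  assumes "n \<ge> 4" "A \<in> ult_carrier n"
  obtains a b where "corner n a b \<in> verts (commuting_graph (ULT n TYPE('p)))"
    "corner n a b * A = A * corner n a b"
proof (cases "A $$ (1, 0) = 0 \<and> A $$ (n - 1, n - 2) = 0")
  case True
  then show ?thesis
    using that[of 1 0] assms corner_in_verts[of n 1 0] corner_commute_iff[of n A] by auto
next
  case False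
  then show ?thesis
    using that[of "A $$ (1, 0)" "A $$ (n - 1, n - 2)"] assms
      corner_in_verts[of n "A $$ (1, 0)" "A $$ (n - 1, n - 2)"] corner_commute_iff[of n A] by auto
qed

text \<open>Here \<open>n \<ge> 4\<close> is essential: for \<open>n = 3\<close> the positions
  \<open>(1, 0)\<close> and \<open>(n - 1, n - 2)\<close> would hold \<open>c\<close> and
  \<open>d\<close> themselves.\<close>

lemma corners_commute:
  fixes a b c d :: "'p :: prime_card mod_ring"
  assumes "n \<ge> 4"
  shows "corner n a b * corner n c d = corner n c d * corner n a b"
proof -
  have "corner n c d \<in> ult_carrier n" using assms by (intro corner_in_ULT) auto
  moreover have "corner n c d $$ (1, 0) = 0" "corner n c d $$ (n - 1, n - 2) = 0"
    using assms by (auto simp: corner_def)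
  ultimately show ?thesis using assms by (subst corner_commute_iff) auto
qed

section \<open>Two vertices with no common neighbour\<close>

text \<open>The unit entry clears column 1 below the diagonal, and constancy along diagonals carries
  these zeros to every entry below the diagonal except the corner, whose diagonal does not meet
  column 1.\<close>

lemma commutes_with_shift_and_unit_entry:
  assumes "n \<ge> 3" and A: "A \<in> carrier (ULT n T)"
    and comm_shift: "(1\<^sub>m n + shift n) * A = A * (1\<^sub>m n + shift n)"
    and comm_unit: "(1\<^sub>m n + unit_entry n 1 0 1) * A = A * (1\<^sub>m n + unit_entry n 1 0 1)"
  shows "A \<in> group_center (ULT n T)"
proof (rule ULT_centerI[OF _ A])
  note A' = ULT_carrierD[OF A]
  have eq: "shift n * A = A * shift n" "unit_entry n 1 0 1 * A = A * unit_entry n 1 0 1"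
    using comm_shift comm_unit A' by (simp_all add: one_plus_commute_iff)
  have toeplitz: "A $$ (Suc i, Suc j) = A $$ (i, j)" if "Suc i < n" "Suc j < n" for i j
    using arg_cong[OF eq(1), of "\<lambda>M. M $$ (Suc i, j)"] that A' by (simp del: index_mult_mat(1))
  have col1: "A $$ (i, 1) = 0" if "i < n" "i > 1" for i
    using arg_cong[OF eq(2), of "\<lambda>M. M $$ (i, 0)"] that A' by (simp del: index_mult_mat(1))
  \<comment> \<open>The diagonal neighbour in column 1 exists only if \<open>Suc i < n\<close>; this
    is what leaves the corner free.\<close>
  have col0: "A $$ (i, 0) = 0" if "0 < i" "Suc i < n" for i
    using toeplitz[of i 0] col1[of "Suc i"] that by simp
  have diag: "A $$ (Suc i + j, Suc j) = 0" if "i > 0" "Suc i + j < n" for i j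
    using that
  proof (induction j)
    case 0
    then show ?case using col1[of "Suc i"] by simp
  next
    case (Suc j)
    then show ?case using toeplitz[of "Suc i + j" "Suc j"] by simp
  qed
  fix i j assume ij: "j < i" "i < n" "(i, j) \<noteq> (n - 1, 0)"
  show "A $$ (i, j) = 0"
  proof (cases j)
    case 0
    then show ?thesis using ij col0[of i] by auto
  next
    case (Suc k)
    then show ?thesis using ij diag[of "i - Suc k" k] by simp
  qed
qed (use assms in simp)

lemma shift_unit_entry_not_commute:
  assumes "n \<ge> 3"
  shows "(1\<^sub>m n + shift n) * (1\<^sub>m n + unit_entry n 1 0 1) \<noteq>
    (1\<^sub>m n + unit_entry n 1 0 1) * (1\<^sub>m n + shift n :: 'a :: comm_ring_1 mat)"
proof
  assume "(1\<^sub>m n + shift n) * (1\<^sub>m n + unit_entry n 1 0 1) =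
    (1\<^sub>m n + unit_entry n 1 0 1) * (1\<^sub>m n + shift n :: 'a mat)"
  then have "shift n * (1\<^sub>m n + unit_entry n 1 0 1) =
      (1\<^sub>m n + unit_entry n 1 0 1) * (shift n :: 'a mat)"
    by (subst (asm) one_plus_commute_iff) auto
  \<comment> \<open>At \<open>(2, 0)\<close> the left product has the entry 1 and the right product
    0.\<close>
  from arg_cong[OF this, of "\<lambda>M. M $$ (2, 0)"] show False
    using assms by (simp del: index_mult_mat(1))
qed

lemma shift_unit_entry_in_verts:
  fixes T :: "'p :: prime_card itself"
  assumes "n \<ge> 3"
  shows "1\<^sub>m n + shift n \<in> verts (commuting_graph (ULT n T))"
    and "1\<^sub>m n + unit_entry n 1 0 1 \<in> verts (commuting_graph (ULT n T))"
proof -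
  note nc = shift_unit_entry_not_commute[OF assms, where 'a = "'p mod_ring"]
  show "1\<^sub>m n + shift n \<in> verts (commuting_graph (ULT n T))"
    using nc by (intro in_verts_commuting_ULT[OF one_plus_shift_in_ULT one_plus_unit_entry_in_ULT]) auto
  show "1\<^sub>m n + unit_entry n 1 0 1 \<in> verts (commuting_graph (ULT n T))"
    by (rule in_verts_commuting_ULT[OF one_plus_unit_entry_in_ULT one_plus_shift_in_ULT])
      (use nc in auto)
qed

section \<open>Disconnectedness for n = 3\<close>

text \<open>The entry of \<open>A * B\<close> at \<open>(2, 0)\<close> is the symmetric sum
  \<open>A $$ (2, 0) + B $$ (2, 0)\<close> plus the left-hand side; that of \<open>B * A\<close> is
  the same sum plus the right-hand side.\<close>

lemma ULT_3_commute:
  assumes A: "A \<in> carrier (ULT 3 T)" and B: "B \<in> carrier (ULT 3 T)" and "A * B = B * A"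
  shows "A $$ (2, 1) * B $$ (1, 0) = B $$ (2, 1) * A $$ (1, 0)"
proof -
  note A' = ULT_carrierD[OF A] and B' = ULT_carrierD[OF B]
  have "(A * B) $$ (2, 0) = (B * A) $$ (2, 0)" using assms by simp
  then show ?thesis
    using A' B' by (simp add: index_mult_mat_sum[of _ 3] numeral_3_eq_3 numeral_2_eq_2
        del: index_mult_mat(1))
qed

lemma ULT_3_not_connected:
  "\<not> Digraph_Component.connected (commuting_graph (ULT 3 TYPE('p :: prime_card)))"
proof -
  let ?G = "ULT 3 TYPE('p)"
  let ?P = "\<lambda>A :: 'p mod_ring mat. A $$ (1, 0) = A $$ (2, 1)"
  show ?thesis
  proof (rule commuting_graph_not_connected[where P = ?P])
    show "1\<^sub>m 3 + shift 3 \<in> verts (commuting_graph ?G)"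
      by (rule shift_unit_entry_in_verts(1)) simp
    show "1\<^sub>m 3 + unit_entry 3 1 0 1 \<in> verts (commuting_graph ?G)"
      by (rule shift_unit_entry_in_verts(2)) simp
    show "?P (1\<^sub>m 3 + shift 3)" "\<not> ?P (1\<^sub>m 3 + unit_entry 3 1 0 1)" by auto
    fix A B :: "'p mod_ring mat"
    assume V: "A \<in> verts (commuting_graph ?G)" "B \<in> verts (commuting_graph ?G)"
      and AB: "A \<otimes>\<^bsub>?G\<^esub> B = B \<otimes>\<^bsub>?G\<^esub> A" and P: "?P A"
    have car: "A \<in> carrier ?G" "B \<in> carrier ?G" and "A \<notin> group_center ?G"
      using V by (auto simp: commuting_graph_def)
    \<comment> \<open>Together with \<open>?P A\<close>, a zero here would leave only the corner
      below the diagonal, making \<open>A\<close> central.\<close>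
    have "A $$ (1, 0) \<noteq> 0"
    proof
      assume 0: "A $$ (1, 0) = 0"
      have "A \<in> group_center ?G"
      proof (rule ULT_centerI[OF _ car(1)])
        fix i j :: nat
        assume "j < i" "i < 3" "(i, j) \<noteq> (3 - 1, 0)"
        then have "i = 1 \<and> j = 0 \<or> i = 2 \<and> j = 1" by simp linarith
        then show "A $$ (i, j) = 0" using 0 P by metis
      qed simp
      then show False using \<open>A \<notin> group_center ?G\<close> by simp
    qed
    \<comment> \<open>Both subdiagonal entries of \<open>A\<close> equal \<open>A $$ (1, 0)\<close>,
      a nonzero field element that can be cancelled.\<close>
    moreover have "A $$ (1, 0) * B $$ (1, 0) = A $$ (1, 0) * B $$ (2, 1)"
      using ULT_3_commute[OF car] AB P by (metis ULT_mult mult.commute)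
    ultimately show "?P B" by simp
  qed
qed

section \<open>Diameter for n at least 4\<close>

lemma ULT_dist_le_3:
  assumes "n \<ge> 4" "A \<in> verts (commuting_graph (ULT n TYPE('p :: prime_card)))"
    "B \<in> verts (commuting_graph (ULT n TYPE('p)))"
  shows "graph_dist (commuting_graph (ULT n TYPE('p))) A B \<le> 3"
proof -
  have car: "A \<in> ult_carrier n" "B \<in> ult_carrier n"
    using assms by (auto simp: commuting_graph_def)
  obtain a b where "corner n a b \<in> verts (commuting_graph (ULT n TYPE('p)))"
    "corner n a b * A = A * corner n a b"
    using exists_commuting_corner[OF assms(1) car(1)] .
  moreover obtain c d where "corner n c d \<in> verts (commuting_graph (ULT n TYPE('p)))"
    "corner n c d * B = B * corner n c d"
    using exists_commuting_corner[OF assms(1) car(2)] .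
  ultimately show ?thesis
    using assms corners_commute[OF assms(1), of a b c d]
    by (intro commuting_graph_dist_le_3[of A _ "corner n a b" "corner n c d" B]) simp_all
qed

lemma ULT_diameter:
  assumes "n \<ge> 4"
  shows "graph_diameter (commuting_graph (ULT n TYPE('p :: prime_card))) = 3"
proof (rule antisym)
  let ?G = "ULT n TYPE('p)"
  let ?J = "1\<^sub>m n + shift n :: 'p mod_ring mat" and ?E = "1\<^sub>m n + unit_entry n 1 0 1 :: 'p mod_ring mat"
  show "graph_diameter (commuting_graph ?G) \<le> 3"
    unfolding graph_diameter_def using ULT_dist_le_3[OF assms] by (intro SUP_least)
  have n: "n \<ge> 3" using assms by simp
  have "3 \<le> graph_dist (commuting_graph ?G) ?J ?E"
    using shift_unit_entry_not_commute[OF n] commutes_with_shift_and_unit_entry[OF n]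
    by (intro commuting_graph_dist_ge_3)
      (simp_all add: one_plus_shift_in_ULT one_plus_unit_entry_in_ULT)
  also have "\<dots> \<le> (SUP B \<in> verts (commuting_graph ?G). graph_dist (commuting_graph ?G) ?J B)"
    using shift_unit_entry_in_verts(2)[OF n] by (rule SUP_upper)
  also have "\<dots> \<le> graph_diameter (commuting_graph ?G)"
    unfolding graph_diameter_def using shift_unit_entry_in_verts(1)[OF n] by (rule SUP_upper)
  finally show "3 \<le> graph_diameter (commuting_graph ?G)" .
qed

theorem proposition4p1:
  shows "\<not> Digraph_Component.connected (commuting_graph (ULT 3 TYPE('p :: prime_card))) \<and>
         (\<forall>n \<ge> 4. graph_diameter (commuting_graph (ULT n TYPE('p))) = 3)"
  using ULT_3_not_connected ULT_diameter by blast

end
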